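(* Let $C_n=\frac{1}{n}\binom{2n-2}{n-1}$ for $n\ge 1$ and $g_n=3^nC_n$, so that $G(x)=\sum_{n\ge1} g_nx^n=\frac{1-\sqrt{1-12x}}{2}$. Let \[ U(x)=\frac{1-\sqrt{1-12x}}{6},\quad F(x)=\frac{-2-\sqrt{1-12x}+\sqrt{5+24x+4\sqrt{1-12x}}}{6},\quad T(x)=\frac{4-\sqrt{1-12x}-\sqrt{5+24x+4\sqrt{1-12x}}}{6}, \] let $I(x)=1+0x+0x^2+\cdots$, and let $\mathbf{K}_3=\{T(x),F(x),U(x),I(x)\}$. Define \[ \mathcal{G}_3=\Big\{A(x)=\sum_n a_nx^n:\ a_n<g_n \text{ for } n>1,\ A(x)\in\{B(x)^a C(x)^b: B(x),C(x)\in\mathbf{K}_3,\ a,b\ge 1\}\Big\}. \] Then $(\mathcal{G}_3,\times)$, with $\times$ the multiplication of formal power series, is a commutative monoid. Moreover, for every $n>1$: (1) $[x^n](A(x)B(x))=[x^n](B(x)A(x))$ for all $A(x),B(x)\in\mathcal{G}_3$; (2) $[x^n]A(x)^m<[x^n]G(x)$ for all $A(x)\in\mathcal{G}_3$ and all $m\ge1$; (3) $[x^n](A(x)^kB(x)^l)<[x^n]G(x)$ for all $A(x),B(x)\in\mathcal{G}_3$ and all $k,l\ge1$; (4) $[x^n]\big((A(x)^kB(x)^l)C(x)^m\big)=[x^n]\big(A(x)^k(B(x)^lC(x)^m)\big)<[x^n]G(x)$ for all $A(x),B(x),C(x)\in\mathcal{G}_3$ and all $k,l,m\ge1$.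
   Context: $[x^n]A(x)$ denotes the coefficient of $x^n$ in the formal power series $A(x)$. The series $U(x),F(x),T(x)$ are the generating functions of the numbers of "unknown", "false" and "true" entries (rows) in the Kleene three-valued truth tables of all bracketed formulae in $n$ distinct variables $p_1,\dots,p_n$ connected by implication (obtained from $p_1\Rightarrow\cdots\Rightarrow p_n$ by inserting brackets), and $G(x)$ is the generating function of the total number $3^nC_n$ of entries in all these truth tables, where the Kleene implication $\phi\Rightarrow\psi$ takes value $1$ if $\phi=0$ or $\psi=1$, value $0$ if $\phi=1,\psi=0$, and value $2$ (unknown) otherwise.
   Formalization: As printed, G_3 (products of two powers) is not closed under multiplication: TF and U lie in it but TFU does not. The formal G_3 allows products of any positive number of powers of elements of K_3; it contains the printed set, so (1)–(4) for the printed set follow. *)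

theory Defs
  imports "HOL-Computational_Algebra.Formal_Power_Series" "HOL-Algebra.Group"
begin

definition catalan_coeff :: "nat \<Rightarrow> real" where
  "catalan_coeff n = 1 / real n * real ((2 * n - 2) choose (n - 1))"

definition g_coeff :: "nat \<Rightarrow> real" where
  "g_coeff n = 3 ^ n * catalan_coeff n"

definition G_ser :: "real fps" where
  "G_ser = Abs_fps (\<lambda>n. if n \<ge> 1 then g_coeff n else 0)"

text \<open>
  For a series with positive constant term, \<^term>\<open>fps_radical root 2\<close> is the square root whose
  constant term is the positive real root.
\<close>

abbreviation fps_sqrt :: "real fps \<Rightarrow> real fps" where
  "fps_sqrt \<equiv> fps_radical root 2"

abbreviation sqrt_disc :: "real fps" where
  "sqrt_disc \<equiv> fps_sqrt (1 - 12 * fps_X)"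

abbreviation sqrt_nested :: "real fps" where
  "sqrt_nested \<equiv> fps_sqrt (5 + 24 * fps_X + 4 * sqrt_disc)"

definition U_ser :: "real fps" where
  "U_ser = fps_const (1 / 6) * (1 - sqrt_disc)"

definition F_ser :: "real fps" where
  "F_ser = fps_const (1 / 6) * (- 2 - sqrt_disc + sqrt_nested)"

definition T_ser :: "real fps" where
  "T_ser = fps_const (1 / 6) * (4 - sqrt_disc - sqrt_nested)"

definition I_ser :: "real fps" where
  "I_ser = Abs_fps (\<lambda>n. if n = 0 then 1 else 0)"

definition K3 :: "real fps set" where
  "K3 = {T_ser, F_ser, U_ser, I_ser}"

text \<open>
  The source takes only products \<open>B ^ a * C ^ b\<close> of two powers (\<open>G3_two\<close> below). That set is
  not closed under multiplication: it contains \<open>T * F\<close> and \<open>U\<close> but not \<open>T * F * U\<close>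
  (\<open>G3_two_not_closed\<close>), so it is not a monoid. \<open>G3\<close> therefore admits products of any
  positive number of powers of elements of \<open>K3\<close>; everything else is as in the source, and
  \<open>G3_two\<close> is contained in \<open>G3\<close>.
\<close>

definition G3 :: "real fps set" where
  "G3 = {A. (\<forall>n>1. fps_nth A n < g_coeff n) \<and>
            A \<in> {\<Prod>i<r. B i ^ a i | (r :: nat) B a. r \<ge> 1 \<and> (\<forall>i<r. B i \<in> K3 \<and> a i \<ge> 1)}}"

definition G3_monoid :: "real fps monoid" where
  "G3_monoid = \<lparr>carrier = G3, mult = (*), one = I_ser\<rparr>"

definition G3_two :: "real fps set" where
  "G3_two = {A. (\<forall>n>1. fps_nth A n < g_coeff n) \<and>
                A \<in> {B ^ a * C ^ b | B C a b. B \<in> K3 \<and> C \<in> K3 \<and> a \<ge> 1 \<and> b \<ge> 1}}"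

lemma G3_two_subset_G3: "G3_two \<subseteq> G3"
proof
  fix A assume A: "A \<in> G3_two"
  then obtain B C a b where *: "A = B ^ a * C ^ b" "B \<in> K3" "C \<in> K3" "a \<ge> 1" "b \<ge> (1::nat)"
    by (auto simp: G3_two_def)
  let ?B = "\<lambda>i::nat. if i = 0 then B else C" and ?a = "\<lambda>i::nat. if i = 0 then a else b"
  have "A = (\<Prod>i<2. ?B i ^ ?a i)"
    using * by (simp add: numeral_2_eq_2)
  moreover have "\<forall>i<2. ?B i \<in> K3 \<and> ?a i \<ge> 1" using * by auto
  ultimately have "A \<in> {\<Prod>i<r. B i ^ a i | (r :: nat) B a. r \<ge> 1 \<and> (\<forall>i<r. B i \<in> K3 \<and> a i \<ge> 1)}"
    by (intro CollectI exI[of _ "2::nat"] exI[of _ ?B] exI[of _ ?a]) auto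
  with A show "A \<in> G3" by (auto simp: G3_def G3_two_def)
qed


lemma sqrt_disc_square: "sqrt_disc * sqrt_disc = 1 - 12 * fps_X"
  using power_radical[of "1 - 12 * fps_X :: real fps" root 1]
  by (simp add: numeral_2_eq_2)

lemma sqrt_disc_nth_0: "fps_nth sqrt_disc 0 = 1"
  by simp

lemma sqrt_nested_nth_0: "fps_nth sqrt_nested 0 = 3"
proof -
  have "root 2 (9::real) = 3"
    by (rule real_root_pos_unique) auto
  then show ?thesis by simp
qed

lemma sqrt_nested_square: "sqrt_nested * sqrt_nested = 5 + 24 * fps_X + 4 * sqrt_disc"
proof -
  have r: "root 2 (9::real) ^ 2 = 9" by simp
  show ?thesis
    using power_radical[of "5 + 24 * fps_X + 4 * sqrt_disc" root 1] r
    by (simp add: numeral_2_eq_2)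
qed

lemma catalan_coeff_Suc:
  assumes "n \<ge> 1"
  shows "real (Suc n) * catalan_coeff (Suc n) = (4 * real n - 2) * catalan_coeff n"
proof -
  obtain m where n: "n = Suc m" using assms by (cases n) auto
  have a: "real (Suc m) * real ((2 * m + 2) choose (Suc m)) =
      real (2 * m + 2) * real ((2 * m + 1) choose m)"
    using arg_cong[OF Suc_times_binomial_eq[of "2 * m + 1" m], of real]
    by (simp only: of_nat_mult) (simp add: mult.commute del: binomial_Suc_Suc)
  have b: "real (Suc m) * real ((2 * m + 1) choose m) = real (2 * m + 1) * real ((2 * m) choose m)"
  proof -
    have "2 * m + 1 - m = Suc m" by simp
    then show ?thesis
      using arg_cong[OF binomial_absorb_comp[of "2 * m + 1" m], of real] by (simp only: of_nat_mult) simp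
  qed
  have "real (Suc m) * (real (Suc m) * real ((2 * m + 2) choose (Suc m))) =
      2 * real (Suc m) * (real (2 * m + 1) * real ((2 * m) choose m))"
    unfolding a using b by (simp add: algebra_simps)
  then have "real (Suc m) * real ((2 * m + 2) choose (Suc m)) =
      2 * (real (2 * m + 1) * real ((2 * m) choose m))"
    using mult_left_cancel[of "real (Suc m)"] by (simp only: mult.assoc mult.left_commute[of 2])
  then show ?thesis
    by (simp add: catalan_coeff_def n field_simps del: binomial_Suc_Suc)
qed


lemma G_ser_closed_form: "G_ser = fps_const (1 / 2) * (1 - sqrt_disc)"
proof -
  let ?s = sqrt_disc
  have "fps_deriv (?s * ?s) = fps_deriv (1 - 12 * fps_X)"
    by (simp only: sqrt_disc_square)
  then have d: "2 * (?s * fps_deriv ?s) = - 12"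
    by (simp add: mult.commute)
  have "2 * ((?s * ?s) * fps_deriv ?s) = ?s * (2 * (?s * fps_deriv ?s))"
    by (simp add: algebra_simps)
  also have "\<dots> = - 12 * ?s"
    unfolding d by simp
  finally have "(1 - 12 * fps_X) * fps_deriv ?s = - 6 * ?s"
    unfolding sqrt_disc_square by (simp add: fps_eq_iff numeral_fps_const neg_numeral_fps_const)
  then have ode: "fps_nth ((1 - 12 * fps_X) * fps_deriv ?s) n = - 6 * fps_nth ?s n" for n
    by (simp add: numeral_fps_const neg_numeral_fps_const)
  have rec: "real (Suc n) * fps_nth ?s (Suc n) = (12 * real n - 6) * fps_nth ?s n" for n
    using ode[of n] by (cases n) (simp_all add: left_diff_distrib mult.assoc numeral_fps_const algebra_simps)
  have "fps_nth ?s (Suc n) = - 2 * g_coeff (Suc n)" for n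
  proof (induction n)
    case 0
    show ?case using rec[of 0] by (simp add: g_coeff_def catalan_coeff_def)
  next
    case (Suc n)
    have "real (Suc (Suc n)) * fps_nth ?s (Suc (Suc n)) =
        - 2 * (12 * real (Suc n) - 6) * g_coeff (Suc n)"
      using rec[of "Suc n"] Suc by (simp add: algebra_simps del: of_nat_Suc)
    also have "\<dots> = - 2 * 3 ^ Suc (Suc n) * ((4 * real (Suc n) - 2) * catalan_coeff (Suc n))"
      by (simp add: g_coeff_def algebra_simps del: of_nat_Suc)
    also have "\<dots> = real (Suc (Suc n)) * (- 2 * g_coeff (Suc (Suc n)))"
      using catalan_coeff_Suc[of "Suc n"] by (simp add: g_coeff_def del: of_nat_Suc)
    finally show ?case
      by (subst (asm) mult_left_cancel) (simp_all del: of_nat_Suc)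
  qed
  then have "fps_nth G_ser n = fps_nth (fps_const (1 / 2) * (1 - ?s)) n" for n
    by (cases n) (simp_all add: G_ser_def)
  then show ?thesis by (simp add: fps_eq_iff)
qed

lemma TFU_sum: "T_ser + F_ser + U_ser = G_ser"
  by (simp add: T_ser_def F_ser_def U_ser_def G_ser_closed_form fps_eq_iff numeral_fps_const
      neg_numeral_fps_const field_simps)

lemma U_ser_eq: "U_ser = fps_const (1 / 3) * G_ser"
  by (simp add: U_ser_def G_ser_closed_form fps_eq_iff field_simps)

lemma const_six: "6 * fps_const (1 / 6) = (1 :: real fps)" 
  by (simp add: numeral_fps_const)

lemma six_ser:
  "6 * T_ser = 4 - sqrt_disc - sqrt_nested"
  "6 * F_ser = - 2 - sqrt_disc + sqrt_nested"
  "6 * U_ser = 1 - sqrt_disc"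
  unfolding T_ser_def F_ser_def U_ser_def by (simp_all only: mult.assoc[symmetric] const_six mult_1_left)

lemma F_ser_rec: "F_ser = fps_X + T_ser * F_ser"
proof -
  let ?s = sqrt_disc and ?r = sqrt_nested
  have "36 * (T_ser * F_ser) = (6 * T_ser) * (6 * F_ser)"
    by (simp add: algebra_simps)
  also have "\<dots> = - 8 - 2 * ?s + 6 * ?r + ?s * ?s - ?r * ?r"
    unfolding six_ser by (simp add: algebra_simps)
  also have "\<dots> = 6 * (6 * F_ser) - 36 * fps_X"
    unfolding six_ser sqrt_disc_square sqrt_nested_square by (simp add: algebra_simps)
  finally have "36 * (T_ser * F_ser) = 36 * (F_ser - fps_X)"
    by (simp add: algebra_simps)
  then have "T_ser * F_ser = F_ser - fps_X"
    by (subst (asm) mult_left_cancel) simp_all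
  then show ?thesis by (simp add: algebra_simps)
qed

lemma G_ser_rec: "G_ser = 3 * fps_X + G_ser * G_ser"
proof -
  have two: "2 * G_ser = 1 - sqrt_disc"
    unfolding G_ser_closed_form by (simp add: mult.assoc[symmetric] numeral_fps_const)
  have "4 * (G_ser * G_ser) = (2 * G_ser) * (2 * G_ser)" by (simp add: algebra_simps)
  also have "\<dots> = 1 - 2 * sqrt_disc + sqrt_disc * sqrt_disc"
    unfolding two by (simp add: algebra_simps)
  also have "\<dots> = 2 * (2 * G_ser) - 12 * fps_X"
    unfolding two sqrt_disc_square by (simp add: algebra_simps)
  finally have "4 * (G_ser * G_ser) = 4 * (G_ser - 3 * fps_X)" by (simp add: algebra_simps)
  then have "G_ser * G_ser = G_ser - 3 * fps_X"
    by (subst (asm) mult_left_cancel) simp_all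
  then show ?thesis by (simp add: algebra_simps)
qed

lemma T_ser_rec: "T_ser = fps_X + G_ser * T_ser + F_ser * F_ser + F_ser * U_ser"
proof -
  have u: "G_ser = 3 * U_ser" unfolding U_ser_eq by (simp add: mult.assoc[symmetric] numeral_fps_const)
  have "3 * U_ser = 3 * (fps_X + U_ser * G_ser)" using G_ser_rec u by (simp add: algebra_simps)
  then have U: "U_ser = fps_X + U_ser * G_ser"
    by (subst (asm) mult_left_cancel) simp_all
  have T: "T_ser = G_ser - F_ser - U_ser" using TFU_sum by (simp add: algebra_simps)
  have F: "T_ser * F_ser = F_ser - fps_X" using F_ser_rec by (simp add: algebra_simps)
  have "fps_X + G_ser * T_ser + F_ser * F_ser + F_ser * U_ser
      = fps_X + G_ser * G_ser - U_ser * G_ser - T_ser * F_ser"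
    unfolding T by (simp add: algebra_simps)
  also have "\<dots> = T_ser"
  proof -
    have "G_ser * G_ser = G_ser - 3 * fps_X" using G_ser_rec by (metis add_diff_cancel_left')
    moreover have "U_ser * G_ser = U_ser - fps_X" using U by (metis add_diff_cancel_left')
    ultimately have "fps_X + G_ser * G_ser - U_ser * G_ser - T_ser * F_ser = G_ser - F_ser - U_ser"
      unfolding F by simp
    then show ?thesis by (simp only: T)
  qed
  finally show ?thesis by simp
qed


lemma ser_nth_0: "fps_nth T_ser 0 = 0" "fps_nth F_ser 0 = 0" "fps_nth U_ser 0 = 0"
    "fps_nth G_ser 0 = 0"
  using sqrt_nested_nth_0 by (simp_all add: T_ser_def F_ser_def U_ser_def G_ser_def del: fps_radical_nth_0)
    (simp_all)

lemma g_coeff_pos: "n \<ge> 1 \<Longrightarrow> g_coeff n > 0"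
  by (auto simp: g_coeff_def catalan_coeff_def)

lemma G_ser_nth: "n \<ge> 1 \<Longrightarrow> fps_nth G_ser n = g_coeff n"
  by (simp add: G_ser_def)

lemma G_ser_nonneg: "fps_nth G_ser n \<ge> 0"
  using g_coeff_pos[of n] by (auto simp: G_ser_def)

lemma U_ser_nth: "fps_nth U_ser n = fps_nth G_ser n / 3"
  by (simp add: U_ser_eq)

lemma T_F_ser_nonneg: "fps_nth T_ser n \<ge> 0 \<and> fps_nth F_ser n \<ge> 0"
proof (induction n rule: less_induct)
  case (less n)
  have m: "fps_nth (A * B) n \<ge> 0"
    if "fps_nth A 0 = 0" "fps_nth B 0 = 0" "\<And>i. i < n \<Longrightarrow> fps_nth A i \<ge> 0" "\<And>i. i < n \<Longrightarrow> fps_nth B i \<ge> 0"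
    for A B :: "real fps"
    unfolding fps_mult_nth
  proof (rule sum_nonneg)
    fix i assume i: "i \<in> {0..n}"
    consider "i = 0" | "i = n" | "i < n" "n - i < n" using i by fastforce
    then show "fps_nth A i * fps_nth B (n - i) \<ge> 0"
      using that by cases auto
  qed
  have "fps_nth F_ser n = fps_nth fps_X n + fps_nth (T_ser * F_ser) n"
    by (subst F_ser_rec) simp
  moreover have "fps_nth T_ser n = fps_nth fps_X n + fps_nth (G_ser * T_ser) n
      + fps_nth (F_ser * F_ser) n + fps_nth (F_ser * U_ser) n"
    by (subst T_ser_rec) simp
  moreover have "fps_nth (fps_X :: real fps) n \<ge> 0" by simp
  ultimately show ?case
    using less m[of T_ser F_ser] m[of G_ser T_ser] m[of F_ser F_ser] m[of F_ser U_ser]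
      ser_nth_0 G_ser_nonneg U_ser_nth by simp
qed

lemma F_ser_less: "n \<ge> 1 \<Longrightarrow> fps_nth F_ser n < g_coeff n"
  using arg_cong[OF TFU_sum, of "\<lambda>A. fps_nth A n"] T_F_ser_nonneg[of n] U_ser_nth[of n]
    G_ser_nth[of n] g_coeff_pos[of n] by simp

lemma TF_in_G3_two: "T_ser * F_ser \<in> G3_two"
proof -
  have "fps_nth (T_ser * F_ser) n < g_coeff n" if "n > 1" for n
    using F_ser_less[of n] that arg_cong[OF F_ser_rec, of "\<lambda>A. fps_nth A n"] by simp
  moreover have "\<exists>B C a b. T_ser * F_ser = B ^ a * C ^ b \<and> B \<in> K3 \<and> C \<in> K3 \<and> a \<ge> 1 \<and> b \<ge> (1::nat)"
    by (rule exI[of _ T_ser], rule exI[of _ F_ser], rule exI[of _ 1], rule exI[of _ 1]) (simp add: K3_def)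
  ultimately show ?thesis by (simp add: G3_two_def)
qed

lemma I_ser_eq_1: "I_ser = 1"
  by (simp add: I_ser_def fps_eq_iff)

lemma U_in_G3_two: "U_ser \<in> G3_two"
proof -
  have "fps_nth U_ser n < g_coeff n" if "n > 1" for n
    using U_ser_nth[of n] G_ser_nth[of n] g_coeff_pos[of n] that by simp
  moreover have "\<exists>B C a b. U_ser = B ^ a * C ^ b \<and> B \<in> K3 \<and> C \<in> K3 \<and> a \<ge> 1 \<and> b \<ge> (1::nat)"
    by (rule exI[of _ U_ser], rule exI[of _ I_ser], rule exI[of _ 1], rule exI[of _ 1])
      (simp add: K3_def I_ser_eq_1)
  ultimately show ?thesis by (simp add: G3_two_def)
qed

lemma ser_nth_values:
  "fps_nth T_ser 1 = 1" "fps_nth T_ser 2 = 5" "fps_nth T_ser 3 = 30"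
  "fps_nth F_ser 1 = 1" "fps_nth F_ser 2 = 1" "fps_nth F_ser 3 = 6"
  "fps_nth U_ser 1 = 1" "fps_nth U_ser 2 = 3" "fps_nth U_ser 3 = 18"
proof -
  have g: "fps_nth G_ser 1 = 3" "fps_nth G_ser 2 = 9" "fps_nth G_ser 3 = 54"
    by (simp_all add: G_ser_def g_coeff_def catalan_coeff_def choose_two)
  show u: "fps_nth U_ser 1 = 1" "fps_nth U_ser 2 = 3" "fps_nth U_ser 3 = 18"
    using g by (simp_all add: U_ser_nth)
  have t: "fps_nth T_ser n = fps_nth G_ser n - fps_nth F_ser n - fps_nth U_ser n" for n
    using arg_cong[OF TFU_sum, of "\<lambda>A. fps_nth A n"] by simp
  have f: "fps_nth F_ser n = fps_nth fps_X n + (\<Sum>i=0..n. fps_nth T_ser i * fps_nth F_ser (n - i))" for n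
    by (subst F_ser_rec) (simp add: fps_mult_nth)
  show f1: "fps_nth F_ser 1 = 1" using f[of 1] by (simp add: ser_nth_0)
  show t1: "fps_nth T_ser 1 = 1" using t[of 1] f1 g u by simp
  show f2: "fps_nth F_ser 2 = 1" using f[of 2] f1 t1 by (simp add: ser_nth_0 numeral_2_eq_2)
  show t2: "fps_nth T_ser 2 = 5" using t[of 2] f2 g u by simp
  show f3: "fps_nth F_ser 3 = 6" using f[of 3] f1 t1 f2 t2 by (simp add: ser_nth_0 numeral_2_eq_2 numeral_3_eq_3)
  show "fps_nth T_ser 3 = 30" using t[of 3] f3 g u by simp
qed

lemma TFU_notin_G3_two: "T_ser * F_ser * U_ser \<notin> G3_two"
proof
  assume "T_ser * F_ser * U_ser \<in> G3_two"
  then obtain B C a b where BC: "T_ser * F_ser * U_ser = B ^ a * C ^ b" "B \<in> K3" "C \<in> K3"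
    by (auto simp: G3_two_def)
  have "\<exists>i j k. B ^ a * C ^ b = T_ser ^ i * F_ser ^ j * U_ser ^ k \<and> (i = 0 \<or> j = 0 \<or> k = 0)"
  proof -
    have single: "\<exists>i j k. D ^ d = T_ser ^ i * F_ser ^ j * U_ser ^ k \<and>
        (D \<noteq> T_ser \<longrightarrow> i = 0) \<and> (D \<noteq> F_ser \<longrightarrow> j = 0) \<and> (D \<noteq> U_ser \<longrightarrow> k = 0)"
      if "D \<in> K3" for D d
    proof -
      have "D = T_ser \<or> D = F_ser \<or> D = U_ser \<or> D = I_ser" using that by (simp add: K3_def)
      then show ?thesis
      proof (elim disjE)
        assume "D = T_ser"
        then have "D ^ d = T_ser ^ d * F_ser ^ 0 * U_ser ^ 0" by simp
        with \<open>D = T_ser\<close> show ?thesis by blast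
      next
        assume "D = F_ser"
        then have "D ^ d = T_ser ^ 0 * F_ser ^ d * U_ser ^ 0" by simp
        with \<open>D = F_ser\<close> show ?thesis by blast
      next
        assume "D = U_ser"
        then have "D ^ d = T_ser ^ 0 * F_ser ^ 0 * U_ser ^ d" by simp
        with \<open>D = U_ser\<close> show ?thesis by blast
      next
        assume "D = I_ser" then show ?thesis by (intro exI[of _ 0]) (auto simp: I_ser_eq_1)
      qed
    qed
    obtain i j k where 1: "B ^ a = T_ser ^ i * F_ser ^ j * U_ser ^ k"
        "B \<noteq> T_ser \<longrightarrow> i = 0" "B \<noteq> F_ser \<longrightarrow> j = 0" "B \<noteq> U_ser \<longrightarrow> k = 0"
      using single[OF BC(2)] by blast
    obtain i' j' k' where 2: "C ^ b = T_ser ^ i' * F_ser ^ j' * U_ser ^ k'"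
        "C \<noteq> T_ser \<longrightarrow> i' = 0" "C \<noteq> F_ser \<longrightarrow> j' = 0" "C \<noteq> U_ser \<longrightarrow> k' = 0"
      using single[OF BC(3)] by blast
    have ne: "T_ser \<noteq> F_ser" "T_ser \<noteq> U_ser" "F_ser \<noteq> U_ser"
      using ser_nth_values by force+
    have "B ^ a * C ^ b = T_ser ^ (i + i') * F_ser ^ (j + j') * U_ser ^ (k + k')"
      using 1(1) 2(1) by (simp add: power_add mult_ac)
    moreover have "i + i' = 0 \<or> j + j' = 0 \<or> k + k' = 0"
      using 1 2 ne by auto
    ultimately show ?thesis by blast
  qed
  then obtain i j k where eq: "T_ser * F_ser * U_ser = T_ser ^ i * F_ser ^ j * U_ser ^ k"
      and z: "i = 0 \<or> j = 0 \<or> k = 0"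
    using BC(1) by auto
  define t f u where tfu: "t = fps_shift 1 T_ser" "f = fps_shift 1 F_ser" "u = fps_shift 1 U_ser"
  have X: "T_ser = fps_X * t" "F_ser = fps_X * f" "U_ser = fps_X * u"
    by (auto simp: tfu fps_eq_iff ser_nth_0)
  have c0: "fps_nth t 0 = 1" "fps_nth f 0 = 1" "fps_nth u 0 = 1"
    using ser_nth_values by (simp_all add: tfu)
  have c1: "fps_nth t 1 = 5" "fps_nth f 1 = 1" "fps_nth u 1 = 3"
    using ser_nth_values by (simp_all add: tfu numeral_2_eq_2)
  have c2: "fps_nth t 2 = 30" "fps_nth f 2 = 6" "fps_nth u 2 = 18"
    using ser_nth_values by (simp_all add: tfu numeral_2_eq_2 numeral_3_eq_3)
  let ?P = "t ^ i * f ^ j * u ^ k"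
  have P0: "fps_nth ?P 0 = 1" by (simp add: c0 fps_power_zeroth)
  have eq': "fps_X ^ 3 * (t * f * u) = fps_X ^ (i + j + k) * ?P"
    using eq by (simp add: X power_mult_distrib power_add power3_eq_cube mult_ac)
  have ijk: "i + j + k = 3"
    using arg_cong[OF eq', of "\<lambda>A. fps_nth A 3"] arg_cong[OF eq', of "\<lambda>A. fps_nth A (i + j + k)"] P0 c0
    by (auto simp: fps_X_power_mult_nth split: if_splits)
  then have e: "t * f * u = ?P" using eq' by simp
  have "fps_nth (t * f * u) 1 = 9" using c0 c1 by (simp add: fps_mult_nth_1)
  moreover have "fps_nth ?P 1 = 5 * real i + real j + 3 * real k"
    using c0 c1 by (simp add: fps_mult_nth_1 fps_power_first_eq fps_power_zeroth del: One_nat_def)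
  ultimately have "5 * real i + real j + 3 * real k = 9" using e by simp
  then have "5 * i + j + 3 * k = 9" by linarith
  with ijk have ij: "i = j" by linarith
  with ijk z have i: "i = 0" by (elim disjE) (simp_all, presburger)
  with ijk ij have "j = 0" "k = 3" by auto
  with e i have "t * f * u = u ^ 3" by simp
  then have "u * (t * f) = u * (u * u)" by (metis power3_eq_cube mult.assoc mult.commute)
  moreover have "u \<noteq> 0" using c0 by auto
  ultimately have "t * f = u * u" by simp
  then have "fps_nth (t * f) 2 = fps_nth (u * u) 2" by simp
  then show False
    using c0 c1 c2 by (simp add: fps_mult_nth numeral_2_eq_2)
qed

lemma G3_two_not_closed: "\<exists>A\<in>G3_two. \<exists>B\<in>G3_two. A * B \<notin> G3_two"
  using TF_in_G3_two U_in_G3_two TFU_notin_G3_two by blast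

lemma G3_two_not_monoid: "\<not> Group.monoid \<lparr>carrier = G3_two, mult = (*), one = I_ser\<rparr>"
proof
  assume "Group.monoid \<lparr>carrier = G3_two, mult = (*), one = I_ser\<rparr>"
  from monoid.m_closed[OF this] show False using G3_two_not_closed by auto
qed

end

theory Submission
  imports Defs
begin

text \<open>
  The recursion \<open>G = 3 x + G\<^sup>2\<close> makes the coefficients of \<open>G\<^sup>2\<close> agree with those of \<open>G\<close> beyond
  degree one. Hence if \<open>A\<close> and \<open>B\<close> have no constant term and nonnegative coefficients strictly
  below those of \<open>G\<close>, then \<open>A B\<close> lies strictly below \<open>G\<^sup>2\<close>, and so again below \<open>G\<close>. Every element
  of \<open>K3\<close> other than the unit is of this kind, so the coefficient bound in the definition of
  \<open>G3\<close> holds automatically for all products.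
\<close>

definition below_G :: "real fps set" where
  "below_G = {A. fps_nth A 0 = 0 \<and> (\<forall>n\<ge>1. 0 \<le> fps_nth A n \<and> fps_nth A n < g_coeff n)}"

lemma G_ser_square_nth:
  assumes "n \<ge> 2"
  shows "fps_nth (G_ser * G_ser) n = g_coeff n"
proof -
  have "fps_nth G_ser n = fps_nth (3 * fps_X + G_ser * G_ser) n"
    using G_ser_rec by simp
  then show ?thesis
    using assms by (simp add: G_ser_nth numeral_fps_const)
qed

lemma mult_below_G:
  assumes A: "A \<in> below_G" and B: "B \<in> below_G"
  shows "A * B \<in> below_G"
proof -
  have nonneg: "0 \<le> fps_nth A i" "0 \<le> fps_nth B i" for i
    using A B by (cases "i = 0"; simp add: below_G_def)+
  have "0 \<le> fps_nth (A * B) n" for n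
    by (simp add: fps_mult_nth nonneg sum_nonneg)
  moreover have "fps_nth (A * B) n < g_coeff n" if "n \<ge> 1" for n
  \<comment> \<open>Degree 1 is separate: without constant terms the coefficient of
    \<open>A * B\<close> there is 0, and \<open>G_ser * G_ser\<close> also has 0 instead of
    \<open>g_coeff 1\<close>.\<close>
  proof (cases "n = 1")
    case True
    then show ?thesis
      using A B g_coeff_pos[of 1] by (simp add: fps_mult_nth below_G_def)
  next
    case False
    with that have n: "n \<ge> 2" by simp
    have le: "fps_nth A i \<le> fps_nth G_ser i" "fps_nth B i \<le> fps_nth G_ser i" for i
      using A B by (cases "i = 0"; simp add: below_G_def G_ser_def less_imp_le)+
    have "(\<Sum>i=0..n. fps_nth A i * fps_nth B (n - i))
        < (\<Sum>i=0..n. fps_nth G_ser i * fps_nth G_ser (n - i))"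
    proof (rule sum_strict_mono_ex1)
      show "\<forall>i\<in>{0..n}. fps_nth A i * fps_nth B (n - i) \<le> fps_nth G_ser i * fps_nth G_ser (n - i)"
        by (intro ballI mult_mono le nonneg G_ser_nonneg)
      \<comment> \<open>The end terms of both convolutions vanish, so strictness must come from
        inside; index 1 works because 1 and \<open>n - 1\<close> are both positive.\<close>
      have "fps_nth A 1 * fps_nth B (n - 1) < fps_nth G_ser 1 * fps_nth G_ser (n - 1)"
        using A B n by (intro mult_strict_mono' nonneg) (simp_all add: below_G_def G_ser_nth)
      then show "\<exists>i\<in>{0..n}. fps_nth A i * fps_nth B (n - i)
          < fps_nth G_ser i * fps_nth G_ser (n - i)"
        using n by (intro bexI[of _ 1]) simp_all
    qed simp
    then show ?thesis
      using G_ser_square_nth[OF n] by (simp add: fps_mult_nth)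
  qed
  ultimately show ?thesis
    using A by (simp add: below_G_def)
qed

text \<open>The unit is adjoined because its constant term 1 keeps it out of
  \<open>below_G\<close>.\<close>

lemma insert_1_below_G_mult:
  "A \<in> insert 1 below_G \<Longrightarrow> B \<in> insert 1 below_G \<Longrightarrow> A * B \<in> insert 1 below_G"
  using mult_below_G by auto

lemma insert_1_below_G_power: "A \<in> insert 1 below_G \<Longrightarrow> A ^ k \<in> insert 1 below_G"
  by (induction k) (simp, simp only: power_Suc insert_1_below_G_mult)

text \<open>In T + F + U = G all summands are nonnegative, and U = G/3 is positive from degree 1 on,
  which leaves T strictly below G.\<close>

lemma K3_subset: "K3 \<subseteq> insert 1 below_G"
proof -
  have "fps_nth T_ser n < g_coeff n" "fps_nth U_ser n < g_coeff n" if "n \<ge> 1" for n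
    using arg_cong[OF TFU_sum, of "\<lambda>A. fps_nth A n"] T_F_ser_nonneg[of n] U_ser_nth[of n]
      G_ser_nth[of n] g_coeff_pos[of n] that by simp_all
  then show ?thesis
    by (auto simp: K3_def below_G_def ser_nth_0 T_F_ser_nonneg F_ser_less I_ser_eq_1
        U_ser_nth G_ser_nonneg)
qed

lemma prod_K3_powers_subset:
  assumes "\<forall>i<(r::nat). B i \<in> K3"
  shows "(\<Prod>i<r. B i ^ a i) \<in> insert 1 below_G"
  using assms
proof (induction r)
  case (Suc r)
  then have "(\<Prod>i<r. B i ^ a i) \<in> insert 1 below_G" "B r ^ a r \<in> insert 1 below_G"
    using K3_subset by (auto intro!: insert_1_below_G_power simp del: insert_iff)
  then show ?case
    by (simp only: prod.lessThan_Suc insert_1_below_G_mult)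
qed simp

text \<open>Membership in \<open>G3\<close> becomes a matter of the shape of a product alone, so
  closure needs no further estimates.\<close>

lemma G3_eq_prod_K3_powers:
  "G3 = {\<Prod>i<r. B i ^ a i | (r :: nat) B a. r \<ge> 1 \<and> (\<forall>i<r. B i \<in> K3 \<and> a i \<ge> 1)}"
proof -
  have "fps_nth (\<Prod>i<r. B i ^ a i) n < g_coeff n"
    if "\<forall>i<r. B i \<in> K3" "n > 1" for r n :: nat and B a
  proof -
    have "(\<Prod>i<r. B i ^ a i) = 1 \<or> (\<Prod>i<r. B i ^ a i) \<in> below_G"
      using prod_K3_powers_subset[OF that(1)] by simp
    then show ?thesis
      using that(2) g_coeff_pos[of n] by (auto simp: below_G_def)
  qed
  then show ?thesis
    unfolding G3_def by blast
qed

lemma one_in_G3: "1 \<in> G3"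
  unfolding G3_eq_prod_K3_powers
  \<comment> \<open>The empty product is excluded by \<open>r \<ge> 1\<close>, so 1 is written as
    the single factor \<open>I_ser ^ 1\<close>.\<close>
  by (intro CollectI exI[of _ 1] exI[of _ "\<lambda>_. I_ser"] exI[of _ "\<lambda>_. 1"])
    (simp add: I_ser_eq_1 K3_def)

lemma prod_lessThan_add:
  fixes h :: "nat \<Rightarrow> 'a :: comm_monoid_mult"
  shows "(\<Prod>i<r + s. h i) = (\<Prod>i<r. h i) * (\<Prod>i<s. h (r + i))"
  by (induction s) (simp_all add: mult.assoc)

lemma mult_in_G3:
  assumes "A \<in> G3" "A' \<in> G3"
  shows "A * A' \<in> G3"
proof -
  obtain r :: nat and B a where A: "A = (\<Prod>i<r. B i ^ a i)" "r \<ge> 1" "\<forall>i<r. B i \<in> K3 \<and> a i \<ge> 1"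
    using assms(1) unfolding G3_eq_prod_K3_powers by blast
  obtain s :: nat and B' a' where A': "A' = (\<Prod>i<s. B' i ^ a' i)" "s \<ge> 1" "\<forall>i<s. B' i \<in> K3 \<and> a' i \<ge> 1"
    using assms(2) unfolding G3_eq_prod_K3_powers by blast
  \<comment> \<open>The two lists of factors are concatenated, the second shifted by
    \<open>r\<close>.\<close>
  let ?B = "\<lambda>i. if i < r then B i else B' (i - r)"
    and ?a = "\<lambda>i. if i < r then a i else a' (i - r)"
  have "A * A' = (\<Prod>i<r + s. ?B i ^ ?a i)"
    unfolding prod_lessThan_add A(1) A'(1) by simp
  moreover have "\<forall>i<r + s. ?B i \<in> K3 \<and> ?a i \<ge> 1"
    using A(3) A'(3) by auto
  ultimately show ?thesis
    unfolding G3_eq_prod_K3_powers using A(2)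
    by (intro CollectI exI[of _ "r + s"] exI[of _ ?B] exI[of _ ?a]) simp
qed

lemma power_in_G3: "A \<in> G3 \<Longrightarrow> A ^ k \<in> G3"
  by (induction k) (simp_all add: one_in_G3 mult_in_G3)

lemma G3_nth_less: "A \<in> G3 \<Longrightarrow> n > 1 \<Longrightarrow> fps_nth A n < fps_nth G_ser n"
  by (simp add: G3_def G_ser_nth)

lemma comm_monoid_G3: "comm_monoid G3_monoid"
  by (rule comm_monoidI)
    (simp_all add: G3_monoid_def mult_in_G3 one_in_G3 I_ser_eq_1 mult.assoc mult.commute)

theorem theorem1:
  shows "G_ser = fps_const (1 / 2) * (1 - fps_sqrt (1 - 12 * fps_X))
    \<and> comm_monoid G3_monoid
    \<and> (\<forall>n>1.
         (\<forall>A\<in>G3. \<forall>B\<in>G3. fps_nth (A * B) n = fps_nth (B * A) n)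
       \<and> (\<forall>A\<in>G3. \<forall>m\<ge>1. fps_nth (A ^ m) n < fps_nth G_ser n)
       \<and> (\<forall>A\<in>G3. \<forall>B\<in>G3. \<forall>k\<ge>1. \<forall>l\<ge>1.
            fps_nth (A ^ k * B ^ l) n < fps_nth G_ser n)
       \<and> (\<forall>A\<in>G3. \<forall>B\<in>G3. \<forall>C\<in>G3. \<forall>k\<ge>1. \<forall>l\<ge>1. \<forall>m\<ge>1.
            fps_nth ((A ^ k * B ^ l) * C ^ m) n = fps_nth (A ^ k * (B ^ l * C ^ m)) n
          \<and> fps_nth (A ^ k * (B ^ l * C ^ m)) n < fps_nth G_ser n))"
  \<comment> \<open>Each bounded series is a product of powers of elements of \<open>G3\<close>,
    hence itself in \<open>G3\<close>, where the bound is part of membership.\<close>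
  by (intro conjI allI ballI impI G_ser_closed_form comm_monoid_G3 G3_nth_less power_in_G3
      mult_in_G3 arg_cong2[where f = fps_nth] mult.commute mult.assoc refl)

end
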